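(* Consider the topic model and the semi-supervised topic modeling algorithm described in the context. Write $\Gamma=[\gamma_1,\dots,\gamma_n]\in\mathbb{R}^{K\times n}$ and $D_0=A\Gamma\in\mathbb{R}^{p\times n}$. Suppose $\mathrm{rank}(A\Gamma)=K$, and that $U\in\mathbb{R}^{n\times K}$ and $\eta\in\mathbb{R}^K$ satisfy $\mathrm{rank}(U)=K$ and $\eta'U'D_0'e_j>0$ for all $1\le j\le p$. If $(K,D_0,A_S^* )$ is plugged into the algorithm (that is, $D$ is replaced by $D_0$), then $\widehat A=A$.
   Context: Model (pLSI). There are $n$ documents, a vocabulary of $p$ words and $K$ topics. Each topic is a probability mass function $A_k\in\mathbb{R}^p$; $A=[A_1,\dots,A_K]\in\mathbb{R}^{p\times K}$. The word count vectors $Y_1,\dots,Y_n$ are independent with $Y_i\sim\mathrm{Multinomial}(N_i,\Omega_i)$, where $N_i$ is the length of document $i$ and $\Omega_i=\sum_{k=1}^K\gamma_i(k)A_k$, with $\gamma_i(k)$ the fractional weight that document $i$ puts on topic $k$ (so $\gamma_i\in\mathbb{R}^K$ has nonnegative entries summing to $1$). $D=[d_1,\dots,d_n]\in\mathbb{R}^{p\times n}$ with $d_i=N_i^{-1}Y_i$. For $1\le j\le p$ let $a_j=(A_1(j),\dots,A_K(j))'\in\mathbb{R}^K$ and $a_j^*=a_j/\|a_j\|_1$ (the topic loading vector). $S\subset\{1,\dots,p\}$ is the set of labeled words, $N=|S|$, and $A_S^*\in\mathbb{R}^{N\times K}$ has rows $(a_j^* )'$, $j\in S$. $e_j$ is the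 $j$-th standard basis vector, $\circ$ is the entrywise product, $\mathrm{diag}(v)$ is the diagonal matrix with diagonal $v$, and a prime denotes transpose. Algorithm, with input $(K,D,A_S^* )$ and parameters $U\in\mathbb{R}^{n\times K}$, $\eta\in\mathbb{R}^K$. Step 1. Compute $x_j=U'D'e_j/(\eta'U'D'e_j)$ for $1\le j\le p$; let $X_S\in\mathbb{R}^{N\times K}$ have rows $x_j'$, $j\in S$. Step 2 (semi-supervised vertex hunting). Write $\Pi_S=A_S^*$ with rows $\pi_j'=(a_j^* )'$, and $H=I_N-\Pi_S(\Pi_S'\Pi_S)^{-1}\Pi_S'$. Compute $\alpha\in\mathbb{R}^N$ with $\|\alpha\|=1$ from $\Pi_S$: either the eigenvector of $HFH$ for its largest eigenvalue, where $F$ is the entrywise square of $\Pi_S\Pi_S'$; or the right eigenvector of $HQ$ for its largest eigenvalue, where $Q$ is the orthogonal projection onto the span of the indicator vectors of the $K+1$ clusters obtained by k-means on $\{\pi_j\}_{j\in S}$. Let $\widehat M(\alpha)=\Pi_S'\mathrm{diag}(H\alpha)X_SX_S'\mathrm{diag}(H\alpha)\Pi_S$ and let $\hat b$ be its eigenvector corresponding to the smallest eigenvalue, with unit Euclidean norm and positive sum of entries. Let $\hat w_j=(\hat b\circ\pi_j)/\|\hat b\circ\pi_j\|_1$ for $j\in S$, let $\widehat W_S$ have rows $\hat w_j'$, and let $\widehat V=(\widehat W_S'\widehat W_S)^{-1}\widehat W_S'X_S$. Step 3. Let $\widehat B=\mathrm{diag}(\hat b)\widehat V$ and output $\widehat A=DU\widehat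 B'(\widehat B\widehat B')^{-1}$.
   Formalization: As stated this is false: scaling η rescales Â. Proved: Â with columns normalized to unit l1 norm equals A, and Â=A if ‖ΓUη‖=1, assuming also all entries of ΓUη are positive, rank A_S^*=K, and b̂ is uniquely determined. *)

theory Defs
  imports "HOL-Analysis.Analysis" "HOL-Library.Disjoint_Sets"
begin

text \<open>
  Matrices are indexed by finite types: \<open>'p\<close> (words), \<open>'n\<close> (documents), \<open>'k\<close> (topics) and
  \<open>'s\<close> (labeled words), so a $p \times K$ matrix has type \<open>real^'k^'p\<close>.
  The set $S$ of labeled words is the range of an injection \<open>s :: 's \<Rightarrow> 'p\<close>.
\<close>

definition norm1 :: "real^'a \<Rightarrow> real"
  where "norm1 v = (\<Sum>i\<in>UNIV. \<bar>v $ i\<bar>)"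

definition diag :: "real^'a \<Rightarrow> real^'a^'a"
  where "diag v = (\<chi> i j. if i = j then v $ i else 0)"

definition prob_vector :: "real^'a \<Rightarrow> bool"
  where "prob_vector v \<longleftrightarrow> (\<forall>i. 0 \<le> v $ i) \<and> (\<Sum>i\<in>UNIV. v $ i) = 1"

definition eigenpair :: "real^'a^'a \<Rightarrow> real \<Rightarrow> real^'a \<Rightarrow> bool"
  where "eigenpair M c v \<longleftrightarrow> v \<noteq> 0 \<and> M *v v = c *\<^sub>R v"

definition top_eigenvector :: "real^'a^'a \<Rightarrow> real^'a \<Rightarrow> bool"
  where "top_eigenvector M v \<longleftrightarrow> (\<exists>c. eigenpair M c v \<and> (\<forall>d w. eigenpair M d w \<longrightarrow> d \<le> c))"

definition bottom_eigenvector :: "real^'a^'a \<Rightarrow> real^'a \<Rightarrow> bool"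
  where "bottom_eigenvector M v \<longleftrightarrow> (\<exists>c. eigenpair M c v \<and> (\<forall>d w. eigenpair M d w \<longrightarrow> c \<le> d))"

definition topic_model :: "real^'k^'p \<Rightarrow> real^'n^'k \<Rightarrow> bool"
  where "topic_model A \<Gamma> \<longleftrightarrow> (\<forall>k. prob_vector (column k A)) \<and> (\<forall>i. prob_vector (column i \<Gamma>))"

definition topic_loading :: "real^'k^'p \<Rightarrow> 'p \<Rightarrow> real^'k"
  where "topic_loading A j = (1 / norm1 (row j A)) *\<^sub>R row j A"

definition labeled_loadings :: "real^'k^'p \<Rightarrow> ('s \<Rightarrow> 'p) \<Rightarrow> real^'k^'s"
  where "labeled_loadings A s = (\<chi> i. topic_loading A (s i))"

definition word_score :: "real^'n^'p \<Rightarrow> real^'k^'n \<Rightarrow> 'p \<Rightarrow> real^'k"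
  where "word_score D U j = transpose U *v (transpose D *v axis j 1)"

definition word_embedding :: "real^'n^'p \<Rightarrow> real^'k^'n \<Rightarrow> real^'k \<Rightarrow> 'p \<Rightarrow> real^'k"
  where "word_embedding D U \<eta> j = (1 / (\<eta> \<bullet> word_score D U j)) *\<^sub>R word_score D U j"

definition labeled_embeddings ::
    "real^'n^'p \<Rightarrow> real^'k^'n \<Rightarrow> real^'k \<Rightarrow> ('s \<Rightarrow> 'p) \<Rightarrow> real^'k^'s"
  where "labeled_embeddings D U \<eta> s = (\<chi> i. word_embedding D U \<eta> (s i))"

definition residual_projection :: "real^'k^'s \<Rightarrow> real^'s^'s"
  where "residual_projection P =
    mat 1 - P ** matrix_inv (transpose P ** P) ** transpose P"

definition squared_gram :: "real^'k^'s \<Rightarrow> real^'s^'s"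
  where "squared_gram P = (\<chi> i j. ((P ** transpose P) $ i $ j)\<^sup>2)"

definition centroid :: "real^'k^'s \<Rightarrow> 's set \<Rightarrow> real^'k"
  where "centroid P C = (1 / real (card C)) *\<^sub>R (\<Sum>i\<in>C. row i P)"

definition within_ss :: "real^'k^'s \<Rightarrow> 's set set \<Rightarrow> real"
  where "within_ss P \<C> = (\<Sum>C\<in>\<C>. \<Sum>i\<in>C. (norm (row i P - centroid P C))\<^sup>2)"

definition kmeans_clustering :: "nat \<Rightarrow> real^'k^'s \<Rightarrow> 's set set \<Rightarrow> bool"
  where "kmeans_clustering m P \<C> \<longleftrightarrow>
    partition_on UNIV \<C> \<and> card \<C> = m \<and>
    (\<forall>\<D>. partition_on UNIV \<D> \<and> card \<D> = m \<longrightarrow> within_ss P \<C> \<le> within_ss P \<D>)"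

definition indicator_vec :: "'s set \<Rightarrow> real^'s"
  where "indicator_vec C = (\<chi> i. indicator C i)"

definition orth_projection_onto :: "(real^'s) set \<Rightarrow> real^'s^'s \<Rightarrow> bool"
  where "orth_projection_onto L Q \<longleftrightarrow>
    (\<forall>x. Q *v x \<in> L \<and> (\<forall>y\<in>L. (x - Q *v x) \<bullet> y = 0))"

text \<open>The two admissible choices of $\alpha$ in the vertex hunting step.\<close>

definition spectral_direction :: "real^'k^'s \<Rightarrow> real^'s \<Rightarrow> bool"
  where "spectral_direction P \<alpha> \<longleftrightarrow>
    top_eigenvector (residual_projection P ** squared_gram P ** residual_projection P) \<alpha>"

definition kmeans_direction :: "real^'k^'s \<Rightarrow> real^'s \<Rightarrow> bool"
  where "kmeans_direction P \<alpha> \<longleftrightarrow>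
    (\<exists>\<C> Q. kmeans_clustering (CARD('k) + 1) P \<C> \<and>
           orth_projection_onto (span (indicator_vec ` \<C>)) Q \<and>
           top_eigenvector (residual_projection P ** Q) \<alpha>)"

definition valid_direction :: "real^'k^'s \<Rightarrow> real^'s \<Rightarrow> bool"
  where "valid_direction P \<alpha> \<longleftrightarrow>
    norm \<alpha> = 1 \<and> (spectral_direction P \<alpha> \<or> kmeans_direction P \<alpha>)"

definition M_hat :: "real^'k^'s \<Rightarrow> real^'k^'s \<Rightarrow> real^'s \<Rightarrow> real^'k^'k"
  where "M_hat P X \<alpha> =
    transpose P ** diag (residual_projection P *v \<alpha>) ** X
      ** transpose X ** diag (residual_projection P *v \<alpha>) ** P"

definition is_b_hat :: "real^'k^'s \<Rightarrow> real^'k^'s \<Rightarrow> real^'s \<Rightarrow> real^'k \<Rightarrow> bool"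
  where "is_b_hat P X \<alpha> b \<longleftrightarrow>
    bottom_eigenvector (M_hat P X \<alpha>) b \<and> norm b = 1 \<and> 0 < (\<Sum>k\<in>UNIV. b $ k)"

text \<open>
  The vector $\hat b$ is determined by the data only if the smallest eigenvalue is simple: an
  eigenspace of dimension at least two contains none or infinitely many unit vectors with positive
  sum.
\<close>

definition b_hat_well_defined :: "real^'k^'s \<Rightarrow> real^'k^'s \<Rightarrow> real^'s \<Rightarrow> bool"
  where "b_hat_well_defined P X \<alpha> \<longleftrightarrow> (\<exists>!b. is_b_hat P X \<alpha> b)"

definition b_hat :: "real^'k^'s \<Rightarrow> real^'k^'s \<Rightarrow> real^'s \<Rightarrow> real^'k"
  where "b_hat P X \<alpha> = (THE b. is_b_hat P X \<alpha> b)"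

text \<open>The product of two vectors is the library's entrywise product.\<close>

definition W_hat :: "real^'k^'s \<Rightarrow> real^'k \<Rightarrow> real^'k^'s"
  where "W_hat P b = (\<chi> i. (1 / norm1 (b * row i P)) *\<^sub>R (b * row i P))"

definition V_hat :: "real^'k^'s \<Rightarrow> real^'k^'s \<Rightarrow> real^'k \<Rightarrow> real^'k^'k"
  where "V_hat P X b =
    matrix_inv (transpose (W_hat P b) ** W_hat P b) ** transpose (W_hat P b) ** X"

definition A_hat ::
    "real^'n^'p \<Rightarrow> real^'k^'s \<Rightarrow> ('s \<Rightarrow> 'p) \<Rightarrow> real^'k^'n \<Rightarrow> real^'k \<Rightarrow> real^'s \<Rightarrow> real^'k^'p"
  where "A_hat D P s U \<eta> \<alpha> =
    (let X = labeled_embeddings D U \<eta> s;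
         b = b_hat P X \<alpha>;
         B = diag b ** V_hat P X b
     in D ** U ** transpose B ** matrix_inv (B ** transpose B))"

text \<open>
  Since $\hat b$ has unit Euclidean norm, $\hat A$ carries a scale that depends on the scale of
  $\eta$ and $U$; rescaling every column to unit $\ell^1$ norm removes it.
\<close>

definition normalize_columns :: "real^'k^'p \<Rightarrow> real^'k^'p"
  where "normalize_columns B = (\<chi> j k. B $ j $ k / norm1 (column k B))"

end

theory Submission
  imports Defs
begin

text \<open>
  Put \<open>G = \<Gamma>U\<close>. Noiseless scores are \<open>x\<^sub>j = G'\<pi>\<^sub>j / (b \<bullet> \<pi>\<^sub>j)\<close> with \<open>b = G\<eta>\<close>, so the matrix of the
  vertex hunting step is \<open>Z'Z\<close> with \<open>Z = G'N\<close> and \<open>N = \<Pi>' diag(h / \<Pi>b) \<Pi>\<close>, where \<open>h = H\<alpha>\<close> is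
  orthogonal to the columns of \<open>\<Pi>\<close>; hence \<open>Nb = \<Pi>'h = 0\<close>. Uniqueness of \<open>b_hat\<close> therefore means
  that the kernel of \<open>Z\<close> is the line through \<open>b\<close>, and \<open>b_hat = b / \<parallel>b\<parallel>\<close>. It also forces \<open>G\<close> to be
  invertible, which the two rank assumptions alone do not: the kernel of \<open>G'\<close> lies in the orthogonal
  complement of \<open>b = G\<eta>\<close>, which is the range of the symmetric matrix \<open>N\<close>. The remaining steps then
  give \<open>B_hat = G / \<parallel>b\<parallel>\<close> and \<open>A_hat = \<parallel>b\<parallel> A\<close>.
\<close>

section \<open>Gram matrices, inverses and diagonal matrices\<close>

lemma inner_transpose_mult: "(transpose A *v x) \<bullet> y = x \<bullet> (A *v y)" for A :: "real^'m^'n"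
  by (simp add: dot_lmul_matrix)

lemma gram_mult_eq_0_iff: "(transpose Z ** Z) *v x = 0 \<longleftrightarrow> Z *v x = 0" for Z :: "real^'m^'n"
proof
  assume "(transpose Z ** Z) *v x = 0"
  then have "(Z *v x) \<bullet> (Z *v x) = 0"
    by (metis inner_transpose_mult matrix_vector_mul_assoc inner_zero_left)
  then show "Z *v x = 0" by simp
qed (simp add: matrix_vector_mul_assoc[symmetric])

lemma invertible_if_kernel_trivial:
  fixes A :: "real^'n^'n"
  assumes "\<And>x. A *v x = 0 \<Longrightarrow> x = 0"
  shows "invertible A"
  using assms matrix_left_invertible_ker[of A] by (auto simp: invertible_left_inverse)

lemma matrix_inv_cancel:
  assumes "invertible A"
  shows "A ** matrix_inv A = mat 1" and "matrix_inv A ** A = mat 1"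
  using someI_ex[OF assms[unfolded invertible_def]] by (simp_all add: matrix_inv_def)

lemma gram_invertible:
  fixes Z :: "real^'m^'n"
  assumes "\<And>x. Z *v x = 0 \<Longrightarrow> x = 0"
  shows "invertible (transpose Z ** Z)"
  using assms by (intro invertible_if_kernel_trivial) (simp add: gram_mult_eq_0_iff)

lemma diag_mult_vec: "diag d *v x = d * x"
  by (simp add: vec_eq_iff diag_def matrix_vector_mult_def
      if_distrib[where f = "\<lambda>c. c * _"] cong: if_cong)

lemma transpose_diag: "transpose (diag d) = diag d"
  by (auto simp: vec_eq_iff diag_def transpose_def)

lemma diag_mult_diag: "diag c ** diag d = diag (c * d)"
  by (simp add: matrix_eq matrix_vector_mul_assoc[symmetric] diag_mult_vec mult.assoc)

lemma diag_mult_row: "(diag d ** A) $ i = d $ i *\<^sub>R A $ i" for A :: "real^'n^'m"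
  by (simp add: vec_eq_iff diag_def matrix_matrix_mult_def
      if_distrib[where f = "\<lambda>c. c * _"] cong: if_cong)

lemma mult_row: "(A ** B) $ i = transpose B *v A $ i" for A :: "real^'n^'m"
  by (simp add: vec_eq_iff matrix_matrix_mult_def matrix_vector_mult_def transpose_def mult.commute)

section \<open>Smallest eigenvectors of a singular Gram matrix, and \<open>b_hat\<close>\<close>

lemma bottom_eigenvector_gram_iff:
  fixes Z :: "real^'m^'n"
  assumes "Z *v b = 0" "b \<noteq> 0"
  shows "bottom_eigenvector (transpose Z ** Z) y \<longleftrightarrow> y \<noteq> 0 \<and> Z *v y = 0"
proof -
  let ?M = "transpose Z ** Z"
  have nonneg: "0 \<le> d" if "eigenpair ?M d w" for d w
  proof -
    have "d * (w \<bullet> w) = (?M *v w) \<bullet> w"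
      using that by (simp add: eigenpair_def)
    also have "\<dots> = (Z *v w) \<bullet> (Z *v w)"
      by (metis inner_transpose_mult matrix_vector_mul_assoc)
    finally have "0 \<le> d * (w \<bullet> w)" by simp
    moreover have "0 < w \<bullet> w" using that by (simp add: eigenpair_def)
    ultimately show ?thesis by (simp add: zero_le_mult_iff)
  qed
  have pair0: "eigenpair ?M 0 w \<longleftrightarrow> w \<noteq> 0 \<and> Z *v w = 0" for w
    by (simp add: eigenpair_def gram_mult_eq_0_iff)
  \<comment> \<open>No eigenvalue is negative, so this makes 0 the smallest one; its eigenvectors
    are the nonzero kernel vectors of \<open>Z\<close>.\<close>
  then have "eigenpair ?M 0 b" using assms by simp
  then show ?thesis
    unfolding bottom_eigenvector_def using nonneg pair0 by (metis order_antisym)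
qed

lemma is_b_hat_normalized:
  assumes Z: "M_hat P X \<alpha> = transpose Z ** Z" "Z *v b = 0" and sum: "0 < (\<Sum>k\<in>UNIV. b $ k)"
  shows "is_b_hat P X \<alpha> ((1 / norm b) *\<^sub>R b)"
proof -
  have "b \<noteq> 0" using sum by auto
  then show ?thesis
    using Z sum bottom_eigenvector_gram_iff[OF Z(2)]
    by (simp add: is_b_hat_def matrix_vector_mult_scaleR sum_divide_distrib[symmetric])
qed

lemma b_hat_eq_normalized:
  assumes "b_hat_well_defined P X \<alpha>" "M_hat P X \<alpha> = transpose Z ** Z" "Z *v b = 0"
    "0 < (\<Sum>k\<in>UNIV. b $ k)"
  shows "b_hat P X \<alpha> = (1 / norm b) *\<^sub>R b"
  unfolding b_hat_def
  using assms is_b_hat_normalized by (metis b_hat_well_defined_def the1_equality)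

text \<open>A kernel vector off the line of \<open>b\<close> could be shifted along \<open>b\<close>
  until its sum is positive; normalized, it would be a second candidate for
  \<open>b_hat\<close>.\<close>

lemma kernel_eq_line_if_well_defined:
  assumes wd: "b_hat_well_defined P X \<alpha>" and Z: "M_hat P X \<alpha> = transpose Z ** Z" "Z *v b = 0"
    and sum: "0 < (\<Sum>k\<in>UNIV. b $ k)" and y: "Z *v y = 0"
  shows "\<exists>c. y = c *\<^sub>R b"
proof -
  \<comment> \<open>Chosen so that the entries of \<open>u\<close> sum to 1.\<close>
  define t where "t = (1 - (\<Sum>k\<in>UNIV. y $ k)) / (\<Sum>k\<in>UNIV. b $ k)"
  define u where "u = y + t *\<^sub>R b"
  have sum_u: "(\<Sum>k\<in>UNIV. u $ k) = 1"
  proof -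
    have "(\<Sum>k\<in>UNIV. u $ k) = (\<Sum>k\<in>UNIV. y $ k) + t * (\<Sum>k\<in>UNIV. b $ k)"
      by (simp add: u_def sum.distrib sum_distrib_left)
    then show ?thesis using sum by (simp add: t_def)
  qed
  then have "u \<noteq> 0" by auto
  have "Z *v u = 0"
    by (simp add: u_def matrix_vector_right_distrib matrix_vector_mult_scaleR y Z(2))
  \<comment> \<open>Both sides equal \<open>b_hat\<close>, since \<open>u\<close> and
    \<open>b\<close> are kernel vectors with positive sum.\<close>
  then have "(1 / norm u) *\<^sub>R u = (1 / norm b) *\<^sub>R b"
    using b_hat_eq_normalized[OF wd Z(1)] Z(2) sum sum_u by (metis zero_less_one)
  then have "norm u *\<^sub>R ((1 / norm u) *\<^sub>R u) = norm u *\<^sub>R ((1 / norm b) *\<^sub>R b)"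
    by simp
  then have "u = (norm u / norm b) *\<^sub>R b"
    using \<open>u \<noteq> 0\<close> by simp
  then have "y = (norm u / norm b - t) *\<^sub>R b"
    by (metis u_def add_diff_cancel_right' scaleR_left_diff_distrib)
  then show ?thesis ..
qed

section \<open>The vertex hunting step\<close>

lemma residual_orthogonal:
  assumes "\<And>x. P *v x = 0 \<Longrightarrow> x = 0"
  shows "transpose P *v (residual_projection P *v \<alpha>) = 0"
proof -
  let ?R = "matrix_inv (transpose P ** P)"
  have "transpose P *v (P *v (?R *v (transpose P *v \<alpha>))) = transpose P *v \<alpha>"
    using matrix_inv_cancel(1)[OF gram_invertible[of P]] assms
    by (metis matrix_vector_mul_assoc matrix_vector_mul_lid)
  then show ?thesis
    by (simp add: residual_projection_def matrix_vector_mult_diff_rdistrib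
        matrix_vector_mult_diff_distrib matrix_vector_mul_assoc[symmetric])
qed

text \<open>The range of a symmetric matrix is the orthogonal complement of its kernel, here the
  line through \<open>b\<close>.\<close>

lemma orthogonal_complement_in_range:
  fixes N :: "real^'n^'n"
  assumes sym: "transpose N = N" and "N *v b = 0" "b \<noteq> 0"
    and ker: "\<And>x. N *v x = 0 \<Longrightarrow> \<exists>c. x = c *\<^sub>R b" and "v \<bullet> b = 0"
  shows "\<exists>u. v = N *v u"
proof -
  have Nb: "(N *v x) \<bullet> b = 0" for x
    by (metis assms(2) inner_transpose_mult inner_zero_right sym)
  \<comment> \<open>Adding \<open>bb'\<close> removes the kernel of \<open>N\<close> without
    changing its action on vectors orthogonal to \<open>b\<close>. The preimage of \<open>v\<close>
    under \<open>T\<close> is such a vector.\<close>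
  define T where "T = N + (\<chi> i j. b $ i * b $ j)"
  have "(\<chi> i j. b $ i * b $ j) *v x = (b \<bullet> x) *\<^sub>R b" for x
    by (simp add: vec_eq_iff matrix_vector_mult_def inner_vec_def sum_distrib_left mult_ac)
  then have T: "T *v x = N *v x + (b \<bullet> x) *\<^sub>R b" for x
    by (simp add: T_def matrix_vector_mult_add_rdistrib)
  then have T_b: "(T *v x) \<bullet> b = (b \<bullet> x) * (b \<bullet> b)" for x
    by (simp add: inner_add_left Nb)
  have "invertible T"
  proof (rule invertible_if_kernel_trivial)
    fix x assume x: "T *v x = 0"
    then have "b \<bullet> x = 0" using T_b[of x] \<open>b \<noteq> 0\<close> by simp
    moreover from this obtain c where "x = c *\<^sub>R b" using x T ker by auto
    ultimately show "x = 0" using \<open>b \<noteq> 0\<close> by simp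
  qed
  then have "v = T *v (matrix_inv T *v v)"
    by (simp add: matrix_vector_mul_assoc matrix_inv_cancel(1))
  moreover from this have "b \<bullet> (matrix_inv T *v v) = 0"
    using T_b[of "matrix_inv T *v v"] assms by simp
  ultimately have "v = N *v (matrix_inv T *v v)" using T by (metis add.right_neutral scaleR_zero_left)
  then show ?thesis ..
qed

text \<open>\<open>P\<close> holds the loadings; \<open>d\<close> carries the normalization of the
  embeddings by \<eta>, since \<open>b \<bullet> \<pi>\<close> is the inner product of \<eta> with
  \<open>G'\<pi>\<close>.\<close>

lemma vertex_hunting:
  fixes P :: "real^'k^'s" and G :: "real^'k^'k" and b :: "real^'k"
  defines "d \<equiv> \<chi> i. 1 / (b \<bullet> P $ i)"
  assumes inj: "\<And>x. P *v x = 0 \<Longrightarrow> x = 0" and X: "X = diag d ** P ** G"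
    and b: "b = G *v \<eta>" and pos: "\<And>k. 0 < b $ k" "\<And>i. 0 < b \<bullet> P $ i"
    and wd: "b_hat_well_defined P X \<alpha>"
  shows "b_hat P X \<alpha> = (1 / norm b) *\<^sub>R b" and "invertible G"
proof -
  define h where "h = residual_projection P *v \<alpha>"
  define N where "N = transpose P ** diag d ** diag h ** P"
  define Z where "Z = transpose G ** N"
  have sum: "0 < (\<Sum>k\<in>UNIV. b $ k)" by (simp add: pos sum_pos)
  then have "b \<noteq> 0" by auto
  \<comment> \<open>Transposition swaps the two diagonal factors, which commute.\<close>
  have sym: "transpose N = N"
    by (simp add: N_def matrix_transpose_mul transpose_diag transpose_transpose
        matrix_mul_assoc[symmetric]) (simp add: matrix_mul_assoc diag_mult_diag mult.commute)
  have Z_eq: "Z = transpose X ** diag h ** P"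
    by (simp add: Z_def N_def X matrix_transpose_mul transpose_diag matrix_mul_assoc)
  have M: "M_hat P X \<alpha> = transpose Z ** Z"
    by (simp add: M_hat_def Z_eq h_def[symmetric] matrix_transpose_mul transpose_diag
        transpose_transpose matrix_mul_assoc)
  \<comment> \<open>The entries of \<open>P *v b\<close> are exactly the reciprocals of those of
    \<open>d\<close>.\<close>
  have "d * (h * (P *v b)) = h"
    using pos(2) by (simp add: vec_eq_iff d_def matrix_mult_dot inner_commute less_imp_neq[symmetric])
  then have Nb: "N *v b = 0"
    using residual_orthogonal[OF inj, where \<alpha> = \<alpha>]
    by (simp add: N_def matrix_vector_mul_assoc[symmetric] diag_mult_vec h_def)
  then have Zb: "Z *v b = 0" by (simp add: Z_def matrix_vector_mul_assoc[symmetric])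
  show "b_hat P X \<alpha> = (1 / norm b) *\<^sub>R b"
    by (rule b_hat_eq_normalized[OF wd M Zb sum])
  have ker_Z: "\<exists>c. x = c *\<^sub>R b" if "Z *v x = 0" for x
    by (rule kernel_eq_line_if_well_defined[OF wd M Zb sum that])
  have "invertible (transpose G)"
  proof (rule invertible_if_kernel_trivial)
    fix v assume v: "transpose G *v v = 0"
    then have "v \<bullet> b = 0"
      unfolding b by (metis inner_transpose_mult inner_zero_left)
    \<comment> \<open>The kernel of \<open>N\<close> lies in that of \<open>Z\<close>, so it is
      confined to the same line.\<close>
    moreover have "\<exists>c. x = c *\<^sub>R b" if "N *v x = 0" for x
      using that ker_Z by (simp add: Z_def matrix_vector_mul_assoc[symmetric])
    ultimately obtain u where u: "v = N *v u"
      using orthogonal_complement_in_range[OF sym Nb \<open>b \<noteq> 0\<close>] by blast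
    then have "Z *v u = 0" using v by (simp add: Z_def matrix_vector_mul_assoc[symmetric])
    \<comment> \<open>\<open>u\<close> is a multiple of \<open>b\<close>, which \<open>N\<close>
      annihilates.\<close>
    then show "v = 0" using ker_Z u Nb by (metis matrix_vector_mult_scaleR scaleR_zero_right)
  qed
  then show "invertible G" by (metis transpose_invertible transpose_transpose)
qed

section \<open>Barycentric weights and simplex vertices\<close>

lemma W_hat_normalized:
  fixes P :: "real^'k^'s"
  assumes pos: "\<And>k. 0 < b $ k" "\<And>i k. 0 \<le> P $ i $ k" and "0 < c"
  shows "W_hat P (c *\<^sub>R b) = diag (\<chi> i. 1 / (b \<bullet> P $ i)) ** P ** diag b"
proof -
  \<comment> \<open>By nonnegativity the norm is a plain sum. The factor \<open>c\<close> then
    cancels, so the unit length of \<open>b_hat\<close> does not affect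
    \<open>W_hat\<close>.\<close>
  have "norm1 (c *\<^sub>R b * P $ i) = c * (b \<bullet> P $ i)" for i
    using assms by (simp add: norm1_def inner_vec_def abs_mult sum_distrib_left less_imp_le mult_ac)
  then show ?thesis
    using \<open>0 < c\<close> by (simp add: vec_eq_iff W_hat_def row_def mult_row[of _ "diag b"] diag_mult_row
        transpose_diag diag_mult_vec del: transpose_matrix_vector)
qed

text \<open>Least squares is exact when \<open>X\<close> factors through a \<open>W_hat\<close> of
  full column rank.\<close>

lemma V_hat_eq:
  assumes "\<And>x. W_hat P b *v x = 0 \<Longrightarrow> x = 0" and "X = W_hat P b ** V"
  shows "V_hat P X b = V"
proof -
  let ?W = "W_hat P b"
  have "V_hat P X b = (matrix_inv (transpose ?W ** ?W) ** (transpose ?W ** ?W)) ** V"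
    by (simp add: V_hat_def assms(2) matrix_mul_assoc)
  moreover have "invertible (transpose ?W ** ?W)" using assms(1) by (rule gram_invertible)
  ultimately show ?thesis by (simp add: matrix_inv_cancel(2))
qed

lemma right_inverse_of_invertible:
  fixes B :: "real^'n^'n"
  assumes "invertible B"
  shows "B ** transpose B ** matrix_inv (B ** transpose B) = mat 1"
  using assms by (intro matrix_inv_cancel(1) invertible_mult) (simp_all add: transpose_invertible)


section \<open>Exact recovery of the topic matrix\<close>

theorem theorem4p2:
  fixes A :: "real^'k^'p" and \<Gamma> :: "real^'n^'k" and D0 :: "real^'n^'p"
    and U :: "real^'k^'n" and \<eta> b :: "real^'k"
    and s :: "'s::finite \<Rightarrow> 'p" and AS :: "real^'k^'s" and \<alpha> :: "real^'s"
  assumes model: "topic_model A \<Gamma>"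
    and D0: "D0 = A ** \<Gamma>"
    and labels: "inj s"
    and AS: "AS = labeled_loadings A s"
    and rank_D0: "rank (A ** \<Gamma>) = CARD('k)"
    and rank_U: "rank U = CARD('k)"
    and word_pos: "\<forall>j. 0 < \<eta> \<bullet> word_score D0 U j"
    and b: "b = (\<Gamma> ** U) *v \<eta>"
    and topic_pos: "\<forall>k. 0 < b $ k"
    and rank_AS: "rank AS = CARD('k)"
    and direction: "valid_direction AS \<alpha>"
    and well_defined: "b_hat_well_defined AS (labeled_embeddings D0 U \<eta> s) \<alpha>"
  shows "normalize_columns (A_hat D0 AS s U \<eta> \<alpha>) = A
    \<and> (norm b = 1 \<longrightarrow> A_hat D0 AS s U \<eta> \<alpha> = A)"
proof -
  define G where "G = \<Gamma> ** U"
  define d where "d = (\<chi> i. 1 / (b \<bullet> AS $ i))"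
  define X where "X = labeled_embeddings D0 U \<eta> s"
  have A_nonneg: "0 \<le> A $ j $ k" and A_sum: "(\<Sum>j\<in>UNIV. A $ j $ k) = 1" for j k
    using model by (auto simp: topic_model_def prob_vector_def column_def)
  have score: "word_score D0 U j = transpose G *v A $ j" for j
  proof -
    have "transpose D0 *v axis j 1 = D0 $ j"
      by (simp add: matrix_vector_mult_basis row_def del: transpose_matrix_vector)
    also have "\<dots> = transpose \<Gamma> *v A $ j" by (simp only: D0 mult_row)
    finally show ?thesis
      by (simp only: word_score_def G_def matrix_transpose_mul matrix_vector_mul_assoc)
  qed
  have b_G: "b = G *v \<eta>" by (simp add: b G_def)
  have "\<eta> \<bullet> word_score D0 U j = b \<bullet> A $ j" for j
    by (metis b_G score inner_transpose_mult inner_commute)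
  then have b_pos: "0 < b \<bullet> A $ j"
    and emb: "word_embedding D0 U \<eta> j = (1 / (b \<bullet> A $ j)) *\<^sub>R (transpose G *v A $ j)" for j
    using word_pos by (simp_all add: word_embedding_def score)
  \<comment> \<open>Positive scores exclude zero rows, so the loadings involve no division by
    zero.\<close>
  have norm_pos: "0 < norm1 (A $ j)" for j
  proof -
    have "A $ j \<noteq> 0" using b_pos[of j] by auto
    then obtain k where "A $ j $ k \<noteq> 0" by (auto simp: vec_eq_iff)
    then show ?thesis unfolding norm1_def by (intro sum_pos2[of _ k]) auto
  qed
  have AS_row: "AS $ i = (1 / norm1 (A $ s i)) *\<^sub>R A $ s i" for i
    by (simp add: AS labeled_loadings_def topic_loading_def row_def)
  have AS_pos: "0 < b \<bullet> AS $ i" for i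
    using b_pos norm_pos by (simp add: AS_row)
  have AS_nonneg: "0 \<le> AS $ i $ k" for i k
    using A_nonneg norm_pos by (simp add: AS_row less_imp_le)
  have X: "X = diag d ** AS ** G"
  proof -
    have "X $ i = (diag d ** AS ** G) $ i" for i
    proof -
      have "(diag d ** AS ** G) $ i = transpose G *v (d $ i *\<^sub>R AS $ i)"
        by (simp only: mult_row[of _ G] diag_mult_row)
      \<comment> \<open>The embedding ignores the scale of a row, so loadings may replace rows of
        \<open>A\<close>.\<close>
      also have "d $ i *\<^sub>R AS $ i = (1 / (b \<bullet> A $ s i)) *\<^sub>R A $ s i"
        using norm_pos[of "s i"] by (simp add: d_def AS_row)
      finally show ?thesis
        by (simp add: X_def labeled_embeddings_def emb matrix_vector_mult_scaleR
            del: transpose_matrix_vector)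
    qed
    then show ?thesis by (simp add: vec_eq_iff)
  qed
  have inj: "x = 0" if "AS *v x = 0" for x
    using that rank_AS full_rank_injective[of AS] matrix_vector_mult_0_right[of AS]
    by (metis injD)
  have b_hat: "b_hat AS X \<alpha> = (1 / norm b) *\<^sub>R b" and "invertible G"
    using vertex_hunting[OF inj X[unfolded d_def] b_G] topic_pos AS_pos well_defined
    by (simp_all add: X_def)
  have "b \<noteq> 0" using topic_pos by auto
  define r where "r = 1 / norm b"
  have "0 < r" using \<open>b \<noteq> 0\<close> by (simp add: r_def)
  \<comment> \<open>The true vertices: rows of \<open>G\<close> scaled to have inner product 1 with
    \<eta>.\<close>
  define V where "V = diag (\<chi> k. 1 / b $ k) ** G"
  have W: "W_hat AS (r *\<^sub>R b) = diag d ** AS ** diag b"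
    unfolding d_def using topic_pos AS_nonneg \<open>0 < r\<close> by (intro W_hat_normalized) auto
  have bb: "b * (\<chi> k. 1 / b $ k) = 1"
    using topic_pos by (simp add: vec_eq_iff less_imp_neq[symmetric])
  have diag1: "diag 1 = mat 1" by (simp add: vec_eq_iff diag_def mat_def)
  have "X = W_hat AS (r *\<^sub>R b) ** V"
  proof -
    have "W_hat AS (r *\<^sub>R b) ** V = diag d ** AS ** (diag b ** diag (\<chi> k. 1 / b $ k)) ** G"
      by (simp add: W V_def matrix_mul_assoc)
    then show ?thesis by (simp add: X diag_mult_diag bb diag1)
  qed
  moreover have "x = 0" if "W_hat AS (r *\<^sub>R b) *v x = 0" for x
  proof -
    have "d * (AS *v (b * x)) = 0"
      using that by (simp add: W matrix_vector_mul_assoc[symmetric] diag_mult_vec)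
    then have "AS *v (b * x) = 0"
      using AS_pos by (simp add: vec_eq_iff d_def less_imp_neq[symmetric])
    then have "b * x = 0" by (rule inj)
    then show "x = 0" using topic_pos by (simp add: vec_eq_iff less_imp_neq[symmetric])
  qed
  ultimately have V: "V_hat AS X (r *\<^sub>R b) = V"
    by (intro V_hat_eq)
  define B where "B = diag (r *\<^sub>R b) ** V"
  have B: "B = r *\<^sub>R G"
  proof -
    have "B = diag ((r *\<^sub>R b) * (\<chi> k. 1 / b $ k)) ** G"
      by (simp add: B_def V_def matrix_mul_assoc diag_mult_diag)
    also have "(r *\<^sub>R b) * (\<chi> k. 1 / b $ k) = r *\<^sub>R 1"
      by (simp add: bb)
    finally show ?thesis by (simp add: vec_eq_iff diag_mult_row)
  qed
  have G_B: "G = norm b *\<^sub>R B" using \<open>b \<noteq> 0\<close> by (simp add: B r_def)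
  have "invertible B" unfolding B using \<open>invertible G\<close> \<open>0 < r\<close> by (simp add: scalar_invertible)
  have "A_hat D0 AS s U \<eta> \<alpha> = D0 ** U ** transpose B ** matrix_inv (B ** transpose B)"
    by (simp add: A_hat_def Let_def X_def[symmetric] b_hat r_def[symmetric] V B_def)
  \<comment> \<open>\<open>D0 U = A G\<close>, and \<open>G\<close> differs from \<open>B\<close>
    only by the scale lost in normalizing \<open>b_hat\<close>.\<close>
  also have "D0 ** U = norm b *\<^sub>R (A ** B)"
    by (simp add: D0 matrix_mul_assoc[symmetric] G_def[symmetric])
      (simp add: G_B matrix_scalar_ac scalar_matrix_assoc)
  also have "norm b *\<^sub>R (A ** B) ** transpose B ** matrix_inv (B ** transpose B) =
      norm b *\<^sub>R (A ** (B ** transpose B ** matrix_inv (B ** transpose B)))"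
    by (simp add: scalar_matrix_assoc[symmetric] matrix_mul_assoc)
  also have "\<dots> = norm b *\<^sub>R A"
    using right_inverse_of_invertible[OF \<open>invertible B\<close>] by simp
  finally have A_hat: "A_hat D0 AS s U \<eta> \<alpha> = norm b *\<^sub>R A" .
  \<comment> \<open>Columns of \<open>A\<close> are probability vectors, so column normalization
    removes exactly the factor \<open>norm b\<close>.\<close>
  have "norm1 (column k (norm b *\<^sub>R A)) = norm b" for k
    using A_nonneg A_sum by (simp add: norm1_def column_def abs_mult sum_distrib_left[symmetric])
  then have "normalize_columns (norm b *\<^sub>R A) = A"
    using \<open>b \<noteq> 0\<close> by (simp add: normalize_columns_def vec_eq_iff)
  then show ?thesis by (simp add: A_hat)
qed

end
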